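(* Let $0<\alpha\le 1$, $a<b$, and let $f,g:[a,b]\to\mathbb{R}$ be functions such that there exist continuous functions $\psi,\varphi:[a,b]\to\mathbb{R}$ with $$f(x)=(I_\alpha^a\psi)(x)+f(a),\qquad g(x)=({}^{b}I_\alpha\varphi)(x)+g(b)\qquad\text{for all }x\in[a,b].$$ Then $$\int_a^b (T_\alpha^a f)(t)\,g(t)\,(t-a)^{\alpha-1}dt=\int_a^b f(t)\,({}^{b}T_\alpha g)(t)\,(b-t)^{\alpha-1}dt+f(b)g(b)-f(a)g(a).$$
   Context: For $0<\alpha\le1$, the left and right conformable fractional integrals of order $\alpha$ are $$(I_\alpha^a \psi)(t)=\int_a^t (x-a)^{\alpha-1}\psi(x)\,dx,\qquad ({}^{b}I_\alpha \varphi)(t)=\int_t^b (b-x)^{\alpha-1}\varphi(x)\,dx .$$ The left conformable fractional derivative starting from $a$ (at $t>a$) and the right conformable fractional derivative terminating at $b$ (at $t<b$) are $$(T_\alpha^a f)(t)=\lim_{\epsilon\to0}\frac{f(t+\epsilon (t-a)^{1-\alpha})-f(t)}{\epsilon},\qquad ({}^{b}T_\alpha g)(t)=-\lim_{\epsilon\to0}\frac{g(t+\epsilon (b-t)^{1-\alpha})-g(t)}{\epsilon},$$ when the limits exist. The integrands in the claim need only be considered on the open interval $(a,b)$. *)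

theory Defs
  imports "HOL-Analysis.Analysis"
begin

text \<open>
  Integrals are Lebesgue integrals over the open interval (the \<open>interval_lebesgue_integral\<close> of the
  library), so the value of \<open>powr\<close> at the possibly singular endpoint plays no role.
\<close>

definition left_conf_integral :: "real \<Rightarrow> real \<Rightarrow> (real \<Rightarrow> real) \<Rightarrow> real \<Rightarrow> real" where
  "left_conf_integral \<alpha> a \<psi> t = (LBINT x=ereal a..ereal t. (x - a) powr (\<alpha> - 1) * \<psi> x)"

definition right_conf_integral :: "real \<Rightarrow> real \<Rightarrow> (real \<Rightarrow> real) \<Rightarrow> real \<Rightarrow> real" where
  "right_conf_integral \<alpha> b \<phi> t = (LBINT x=ereal t..ereal b. (b - x) powr (\<alpha> - 1) * \<phi> x)"

definition left_conf_quotient ::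
    "real \<Rightarrow> real \<Rightarrow> (real \<Rightarrow> real) \<Rightarrow> real \<Rightarrow> real \<Rightarrow> real" where
  "left_conf_quotient \<alpha> a f t \<epsilon> = (f (t + \<epsilon> * (t - a) powr (1 - \<alpha>)) - f t) / \<epsilon>"

definition right_conf_quotient ::
    "real \<Rightarrow> real \<Rightarrow> (real \<Rightarrow> real) \<Rightarrow> real \<Rightarrow> real \<Rightarrow> real" where
  "right_conf_quotient \<alpha> b g t \<epsilon> = (g (t + \<epsilon> * (b - t) powr (1 - \<alpha>)) - g t) / \<epsilon>"

text \<open>
  The derivatives are meant for \<open>t > a\<close> and \<open>t < b\<close> respectively. \<open>Lim\<close> is unspecified when the limit
  does not exist; existence is expressed by the two differentiability predicates. At an interior
  point of an interval the limits depend only on the values of the function inside that interval.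
\<close>

definition left_conf_differentiable :: "real \<Rightarrow> real \<Rightarrow> (real \<Rightarrow> real) \<Rightarrow> real \<Rightarrow> bool" where
  "left_conf_differentiable \<alpha> a f t \<longleftrightarrow> (\<exists>l. (left_conf_quotient \<alpha> a f t \<longlongrightarrow> l) (at 0))"

definition right_conf_differentiable :: "real \<Rightarrow> real \<Rightarrow> (real \<Rightarrow> real) \<Rightarrow> real \<Rightarrow> bool" where
  "right_conf_differentiable \<alpha> b g t \<longleftrightarrow> (\<exists>l. (right_conf_quotient \<alpha> b g t \<longlongrightarrow> l) (at 0))"

definition left_conf_deriv :: "real \<Rightarrow> real \<Rightarrow> (real \<Rightarrow> real) \<Rightarrow> real \<Rightarrow> real" where
  "left_conf_deriv \<alpha> a f t = Lim (at 0) (left_conf_quotient \<alpha> a f t)"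

definition right_conf_deriv :: "real \<Rightarrow> real \<Rightarrow> (real \<Rightarrow> real) \<Rightarrow> real \<Rightarrow> real" where
  "right_conf_deriv \<alpha> b g t = - Lim (at 0) (right_conf_quotient \<alpha> b g t)"

end

theory Submission
  imports Defs
begin

text \<open>
  At an interior point the ordinary derivatives are \<open>f' = (t - a) powr (\<alpha> - 1) * \<psi>\<close> and
  \<open>g' = - (b - t) powr (\<alpha> - 1) * \<phi>\<close>, and the conformable derivatives are \<open>f'\<close> and \<open>- g'\<close> with the
  weights removed, that is \<open>\<psi>\<close> and \<open>\<phi>\<close>. The claim thus becomes integration by parts for \<open>f\<close> and
  \<open>g\<close>, which are continuous on the closed interval and have absolutely integrable derivatives
  on the open one.
\<close>

text \<open>The quotient is the difference quotient at 0 of f composed with the affine map sending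
  \<epsilon> to t + \<epsilon> c, so the chain rule gives the limit, with no case split on c =
  0.\<close>

lemma real_quotient_tendsto_along_step:
  fixes f :: "real \<Rightarrow> real"
  assumes "(f has_real_derivative D) (at t)"
  shows "((\<lambda>\<epsilon>. (f (t + \<epsilon> * c) - f t) / \<epsilon>) \<longlongrightarrow> D * c) (at 0)"
proof -
  have f: "(f has_real_derivative D) (at (t + 0 * c))"
    using assms by simp
  have "((\<lambda>\<epsilon>. f (t + \<epsilon> * c)) has_real_derivative D * c) (at 0)"
    by (rule DERIV_chain2[where g = "\<lambda>\<epsilon>. t + \<epsilon> * c", OF f])
      (auto intro!: derivative_eq_intros)
  then show ?thesis
    by (simp add: DERIV_def)
qed

text \<open>The step factor \<open>(t - a) powr (1 - \<alpha>)\<close> is the reciprocal of the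
  weight in the derivative. Strict inequality keeps the base nonzero, as \<open>0 powr 0\<close> is
  0.\<close>

lemma left_conf_quotient_tendsto:
  assumes "a < t" and "(f has_real_derivative (t - a) powr (\<alpha> - 1) * y) (at t)"
  shows "(left_conf_quotient \<alpha> a f t \<longlongrightarrow> y) (at 0)"
proof -
  have "(t - a) powr (\<alpha> - 1) * (t - a) powr (1 - \<alpha>) = 1"
    using assms(1) by (simp flip: powr_add)
  then have "(t - a) powr (\<alpha> - 1) * y * (t - a) powr (1 - \<alpha>) = y"
    by (simp add: mult.commute mult.left_commute)
  then show ?thesis
    using real_quotient_tendsto_along_step[OF assms(2), of "(t - a) powr (1 - \<alpha>)"]
    unfolding left_conf_quotient_def by (simp only:)
qed

lemma right_conf_quotient_tendsto:
  assumes "t < b" and "(g has_real_derivative - ((b - t) powr (\<alpha> - 1) * y)) (at t)"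
  shows "(right_conf_quotient \<alpha> b g t \<longlongrightarrow> - y) (at 0)"
proof -
  have "(b - t) powr (\<alpha> - 1) * (b - t) powr (1 - \<alpha>) = 1"
    using assms(1) by (simp flip: powr_add)
  then have "(b - t) powr (\<alpha> - 1) * y * (b - t) powr (1 - \<alpha>) = y"
    by (simp add: mult.commute mult.left_commute)
  then show ?thesis
    using real_quotient_tendsto_along_step[OF assms(2), of "(b - t) powr (1 - \<alpha>)"]
    unfolding right_conf_quotient_def by (simp only: mult_minus_left)
qed

text \<open>The weight may blow up at a, but its antiderivative
  \<open>(x - a) powr \<alpha> / \<alpha>\<close> is continuous there because \<alpha> > 0. The
  fundamental theorem with derivatives only in the interior therefore applies, and nonnegativity
  makes the integrability absolute.\<close>

lemma absolutely_integrable_powr_left: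
  fixes \<alpha> a b :: real
  assumes "0 < \<alpha>" "a \<le> b"
  shows "(\<lambda>x. (x - a) powr (\<alpha> - 1)) absolutely_integrable_on {a..b}"
proof (rule nonnegative_absolutely_integrable_1)
  have "((\<lambda>x. (x - a) powr (\<alpha> - 1)) has_integral
      (b - a) powr \<alpha> / \<alpha> - (a - a) powr \<alpha> / \<alpha>) {a..b}"
  proof (rule fundamental_theorem_of_calculus_interior)
    show "continuous_on {a..b} (\<lambda>x. (x - a) powr \<alpha> / \<alpha>)"
      using assms by (intro continuous_intros continuous_on_powr') auto
    show "((\<lambda>x. (x - a) powr \<alpha> / \<alpha>) has_vector_derivative (x - a) powr (\<alpha> - 1)) (at x)"
      if "x \<in> {a<..<b}" for x
      unfolding has_real_derivative_iff_has_vector_derivative[symmetric]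
      using that assms by (auto intro!: derivative_eq_intros simp: powr_diff)
  qed (fact assms)
  then show "(\<lambda>x. (x - a) powr (\<alpha> - 1)) integrable_on {a..b}"
    by blast
qed simp

lemma absolutely_integrable_powr_right:
  fixes \<alpha> a b :: real
  assumes "0 < \<alpha>" "a \<le> b"
  shows "(\<lambda>x. (b - x) powr (\<alpha> - 1)) absolutely_integrable_on {a..b}"
  \<comment> \<open>Reflection about 0 turns the weight based at b into the left weight on the
    interval from -b to -a.\<close>
  using absolutely_integrable_powr_left[of \<alpha> "- b" "- a"] assms
    absolutely_integrable_reflect_real[where f = "\<lambda>x. (b - x) powr (\<alpha> - 1)"
      and a = a and b = b]
  by (simp add: add.commute)

text \<open>A continuous function on a compact interval is bounded and measurable, and such a factor
  preserves absolute integrability.\<close>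

lemma absolutely_integrable_mult_continuous:
  fixes u h :: "real \<Rightarrow> real"
  assumes "u absolutely_integrable_on {a..b}" and "continuous_on {a..b} h"
  shows "(\<lambda>x. u x * h x) absolutely_integrable_on {a..b}"
proof -
  have "(\<lambda>x. h x * u x) absolutely_integrable_on {a..b}"
    using assms
    by (intro absolutely_integrable_bounded_measurable_product_real
          continuous_imp_measurable_on_sets_lebesgue compact_imp_bounded compact_continuous_image) auto
  then show ?thesis
    by (simp add: mult.commute)
qed

text \<open>This links the gauge integral, where the calculus is done, to the interval integral over
  \<open>lborel\<close>. Absolute integrability refers to the completed measure; continuity on the
  open interval supplies the Borel measurability that brings it down to \<open>lborel\<close>. The
  endpoints, where u may be singular, form a null set.\<close>

lemma interval_lebesgue_integrable_continuous:
  fixes u :: "real \<Rightarrow> real"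
  assumes "a \<le> b" and u: "u absolutely_integrable_on {a..b}" and cont: "continuous_on {a<..<b} u"
  shows "interval_lebesgue_integrable lborel (ereal a) (ereal b) u"
    and "(LBINT x=ereal a..ereal b. u x) = integral {a..b} u"
proof -
  have "u absolutely_integrable_on {a<..<b}"
    using u by (simp add: absolutely_integrable_on_Icc_iff_Ioo)
  then have *: "set_integrable lborel {a<..<b} u"
    unfolding set_integrable_def
    using borel_measurable_continuous_on_indicator[OF _ cont] by (simp add: integrable_completion)
  then show "interval_lebesgue_integrable lborel (ereal a) (ereal b) u"
    using assms(1) by (simp add: interval_lebesgue_integrable_def)
  show "(LBINT x=ereal a..ereal b. u x) = integral {a..b} u"
    using assms(1) * interval_integral_eq_integral'[of "ereal a" "ereal b" u]
    by (simp add: integral_open_interval_real)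
qed

text \<open>Continuity up to the endpoints comes from integrability of u alone, while
  differentiability at t comes from continuity of u at t.\<close>

lemma antiderivative_from_left:
  fixes u :: "real \<Rightarrow> real"
  assumes u: "u absolutely_integrable_on {a..b}" and cont: "continuous_on {a<..<b} u"
    and F: "\<And>x. x \<in> {a..b} \<Longrightarrow> F x = (LBINT y=ereal a..ereal x. u y) + c"
  shows "continuous_on {a..b} F"
    and "\<And>t. t \<in> {a<..<b} \<Longrightarrow> (F has_real_derivative u t) (at t)"
proof -
  have int: "u integrable_on {a..b}"
    using u by (rule set_lebesgue_integral_eq_integral)
  have eq: "F x = integral {a..x} u + c" if "x \<in> {a..b}" for x
  proof -
    have "u absolutely_integrable_on {a..x}"
      by (rule absolutely_integrable_on_subinterval[OF u]) (use that in auto)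
    moreover have "continuous_on {a<..<x} u"
      by (rule continuous_on_subset[OF cont]) (use that in auto)
    ultimately show ?thesis
      using interval_lebesgue_integrable_continuous(2)[of a x u] F[OF that] that by simp
  qed
  have "continuous_on {a..b} (\<lambda>x. integral {a..x} u + c)"
    using indefinite_integral_continuous_1[OF int] by (intro continuous_intros)
  then show "continuous_on {a..b} F"
    by (rule continuous_on_eq) (simp add: eq)
  show "(F has_real_derivative u t) (at t)" if t: "t \<in> {a<..<b}" for t
  proof -
    have "isCont u t"
      using cont t continuous_on_eq_continuous_at[OF open_greaterThanLessThan] by blast
    then have "continuous (at t within {a..b}) u"
      by (rule continuous_at_imp_continuous_at_within)
    then have "((\<lambda>x. integral {a..x} u) has_vector_derivative u t) (at t within {a..b})"
      \<comment> \<open>The empty set instantiates the finite exceptional set of the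
        theorem.\<close>
      using integral_has_vector_derivative_continuous_at[OF int, of t "{}"] t by simp
    then have "((\<lambda>x. integral {a..x} u) has_real_derivative u t) (at t)"
      using t at_within_Icc_at[of a t b] by (simp add: has_real_derivative_iff_has_vector_derivative)
    then have "((\<lambda>x. integral {a..x} u + c) has_real_derivative u t) (at t)"
      by (auto intro!: derivative_eq_intros)
    \<comment> \<open>F is known to equal the indefinite integral only on the interval, so the
      derivative is transferred on an open neighbourhood of t inside it.\<close>
    then show ?thesis
      by (rule has_field_derivative_transform_within_open[where S = "{a<..<b}"]) (use t eq in auto)
  qed
qed

text \<open>Reflection about 0 makes b the base point -b of an integral from the left; undoing it
  flips the sign of the derivative.\<close>

lemma antiderivative_from_right:
  fixes v :: "real \<Rightarrow> real"
  assumes v: "v absolutely_integrable_on {a..b}" and cont: "continuous_on {a<..<b} v"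
    and G: "\<And>x. x \<in> {a..b} \<Longrightarrow> G x = (LBINT y=ereal x..ereal b. v y) + c"
  shows "continuous_on {a..b} G"
    and "\<And>t. t \<in> {a<..<b} \<Longrightarrow> (G has_real_derivative - v t) (at t)"
proof -
  have v': "(\<lambda>x. v (- x)) absolutely_integrable_on {- b..- a}"
    using v by simp
  have cont': "continuous_on {- b<..<- a} (\<lambda>x. v (- x))"
    by (rule continuous_on_compose2[OF cont]) (auto intro!: continuous_intros)
  have G': "G (- x) = (LBINT y=ereal (- b)..ereal x. v (- y)) + c" if "x \<in> {- b..- a}" for x
    using G[of "- x"] that interval_integral_reflect[of "ereal (- x)" "ereal b" v] by simp
  have reflected: "continuous_on {- b..- a} (\<lambda>x. G (- x))"
    "\<And>t. t \<in> {- b<..<- a} \<Longrightarrow> ((\<lambda>x. G (- x)) has_real_derivative v (- t)) (at t)"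
    by (rule antiderivative_from_left[OF v' cont' G']; assumption)+
  have "continuous_on {a..b} (\<lambda>x. G (- (- x)))"
    by (rule continuous_on_compose2[OF reflected(1)]) (auto intro!: continuous_intros)
  then show "continuous_on {a..b} G"
    by simp
  show "(G has_real_derivative - v t) (at t)" if "t \<in> {a<..<b}" for t
    using reflected(2)[of "- t"] that DERIV_mirror[of "\<lambda>x. G (- x)" "v t" t] by simp
qed

text \<open>The fundamental theorem is applied to the product F G, which is continuous on the closed
  interval and differentiable inside. Each product of a derivative with a continuous factor is
  integrable on its own, so the integral of the sum splits.\<close>

lemma interval_integral_by_parts:
  fixes F G u v :: "real \<Rightarrow> real"
  assumes "a < b"
    and F: "continuous_on {a..b} F" "\<And>t. t \<in> {a<..<b} \<Longrightarrow> (F has_real_derivative u t) (at t)"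
    and G: "continuous_on {a..b} G" "\<And>t. t \<in> {a<..<b} \<Longrightarrow> (G has_real_derivative v t) (at t)"
    and u: "u absolutely_integrable_on {a..b}" "continuous_on {a<..<b} u"
    and v: "v absolutely_integrable_on {a..b}" "continuous_on {a<..<b} v"
  shows "interval_lebesgue_integrable lborel (ereal a) (ereal b) (\<lambda>t. u t * G t)"
    and "interval_lebesgue_integrable lborel (ereal a) (ereal b) (\<lambda>t. v t * F t)"
    and "(LBINT t=ereal a..ereal b. u t * G t) + (LBINT t=ereal a..ereal b. v t * F t) =
      F b * G b - F a * G a"
proof -
  have uG: "(\<lambda>t. u t * G t) absolutely_integrable_on {a..b}"
    using u(1) G(1) by (rule absolutely_integrable_mult_continuous)
  have vF: "(\<lambda>t. v t * F t) absolutely_integrable_on {a..b}"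
    using v(1) F(1) by (rule absolutely_integrable_mult_continuous)
  have FG: "continuous_on {a<..<b} F" "continuous_on {a<..<b} G"
    using F(1) G(1) by (auto elim: continuous_on_subset)
  have cuG: "continuous_on {a<..<b} (\<lambda>t. u t * G t)"
    and cvF: "continuous_on {a<..<b} (\<lambda>t. v t * F t)"
    using u(2) v(2) FG by (auto intro!: continuous_intros)
  note IG = interval_lebesgue_integrable_continuous[OF less_imp_le[OF \<open>a < b\<close>] uG cuG]
  note IF = interval_lebesgue_integrable_continuous[OF less_imp_le[OF \<open>a < b\<close>] vF cvF]
  show "interval_lebesgue_integrable lborel (ereal a) (ereal b) (\<lambda>t. u t * G t)"
    and "interval_lebesgue_integrable lborel (ereal a) (ereal b) (\<lambda>t. v t * F t)"
    by (fact IG(1) IF(1))+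
  have "((\<lambda>t. u t * G t + v t * F t) has_integral F b * G b - F a * G a) {a..b}"
  proof (rule fundamental_theorem_of_calculus_interior)
    show "continuous_on {a..b} (\<lambda>t. F t * G t)"
      using F(1) G(1) by (intro continuous_intros)
    show "((\<lambda>t. F t * G t) has_vector_derivative u t * G t + v t * F t) (at t)"
      if "t \<in> {a<..<b}" for t
      unfolding has_real_derivative_iff_has_vector_derivative[symmetric]
      by (rule DERIV_mult'[OF F(2)[OF that] G(2)[OF that], THEN DERIV_cong]) simp
  qed (use \<open>a < b\<close> in simp)
  then have "integral {a..b} (\<lambda>t. u t * G t + v t * F t) = F b * G b - F a * G a"
    by (rule integral_unique)
  moreover have "integral {a..b} (\<lambda>t. u t * G t + v t * F t) =
      integral {a..b} (\<lambda>t. u t * G t) + integral {a..b} (\<lambda>t. v t * F t)"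
    using uG vF by (intro integral_add) (auto dest: set_lebesgue_integral_eq_integral(1))
  ultimately show "(LBINT t=ereal a..ereal b. u t * G t) + (LBINT t=ereal a..ereal b. v t * F t) =
      F b * G b - F a * G a"
    using IG(2) IF(2) by simp
qed

text \<open>The conformable derivatives are computed only at interior points; this allows the
  integrands to be replaced on that basis.\<close>

lemma interval_lebesgue_cong_Ioo:
  fixes f g :: "real \<Rightarrow> real"
  assumes "a < b" and "\<And>x. x \<in> {a<..<b} \<Longrightarrow> f x = g x"
  shows "interval_lebesgue_integrable lborel (ereal a) (ereal b) f \<longleftrightarrow>
      interval_lebesgue_integrable lborel (ereal a) (ereal b) g"
    and "(LBINT x=ereal a..ereal b. f x) = (LBINT x=ereal a..ereal b. g x)"
proof -
  show "interval_lebesgue_integrable lborel (ereal a) (ereal b) f \<longleftrightarrow>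
      interval_lebesgue_integrable lborel (ereal a) (ereal b) g"
    using assms set_integrable_cong[OF refl refl, of "{a<..<b}" f g lborel]
    by (simp add: interval_lebesgue_integrable_def)
  show "(LBINT x=ereal a..ereal b. f x) = (LBINT x=ereal a..ereal b. g x)"
    using assms by (intro interval_integral_cong) (auto simp: min_def max_def)
qed

theorem theorem3p5:
  fixes \<alpha> a b :: real and f g :: "real \<Rightarrow> real"
  assumes "0 < \<alpha>" and "\<alpha> \<le> 1" and "a < b"
    and "\<exists>\<psi>. continuous_on {a..b} \<psi> \<and> (\<forall>x\<in>{a..b}. f x = left_conf_integral \<alpha> a \<psi> x + f a)"
    and "\<exists>\<phi>. continuous_on {a..b} \<phi> \<and> (\<forall>x\<in>{a..b}. g x = right_conf_integral \<alpha> b \<phi> x + g b)"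
  shows "(\<forall>t\<in>{a<..<b}. left_conf_differentiable \<alpha> a f t \<and> right_conf_differentiable \<alpha> b g t) \<and>
    interval_lebesgue_integrable lborel (ereal a) (ereal b)
      (\<lambda>t. left_conf_deriv \<alpha> a f t * g t * (t - a) powr (\<alpha> - 1)) \<and>
    interval_lebesgue_integrable lborel (ereal a) (ereal b)
      (\<lambda>t. f t * right_conf_deriv \<alpha> b g t * (b - t) powr (\<alpha> - 1)) \<and>
    (LBINT t=ereal a..ereal b. left_conf_deriv \<alpha> a f t * g t * (t - a) powr (\<alpha> - 1)) =
      (LBINT t=ereal a..ereal b. f t * right_conf_deriv \<alpha> b g t * (b - t) powr (\<alpha> - 1))
        + f b * g b - f a * g a"
proof -
  obtain \<psi> where \<psi>: "continuous_on {a..b} \<psi>"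
    and f: "\<And>x. x \<in> {a..b} \<Longrightarrow> f x = left_conf_integral \<alpha> a \<psi> x + f a"
    using assms(4) by blast
  obtain \<phi> where \<phi>: "continuous_on {a..b} \<phi>"
    and g: "\<And>x. x \<in> {a..b} \<Longrightarrow> g x = right_conf_integral \<alpha> b \<phi> x + g b"
    using assms(5) by blast
  define u where "u = (\<lambda>t. (t - a) powr (\<alpha> - 1) * \<psi> t)"
  define v where "v = (\<lambda>t. (b - t) powr (\<alpha> - 1) * \<phi> t)"
  \<comment> \<open>Both are an integrable weight times a continuous function; on the open interval
    the bases are positive, so the weights are continuous there.\<close>
  have u: "u absolutely_integrable_on {a..b}" "continuous_on {a<..<b} u"
    and v: "v absolutely_integrable_on {a..b}" "continuous_on {a<..<b} v"
    unfolding u_def v_def using assms(1,3) \<psi> \<phi>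
    by (auto intro!: absolutely_integrable_mult_continuous absolutely_integrable_powr_left
        absolutely_integrable_powr_right continuous_on_mult continuous_on_powr
        continuous_on_diff continuous_on_id continuous_on_const elim: continuous_on_subset)
  have F: "continuous_on {a..b} f" "\<And>t. t \<in> {a<..<b} \<Longrightarrow> (f has_real_derivative u t) (at t)"
    by (rule antiderivative_from_left[OF u f[unfolded left_conf_integral_def, folded u_def]];
        assumption)+
  have G: "continuous_on {a..b} g" "\<And>t. t \<in> {a<..<b} \<Longrightarrow> (g has_real_derivative - v t) (at t)"
    by (rule antiderivative_from_right[OF v g[unfolded right_conf_integral_def, folded v_def]];
        assumption)+
  have left: "(left_conf_quotient \<alpha> a f t \<longlongrightarrow> \<psi> t) (at 0)" if "t \<in> {a<..<b}" for t
    using F(2)[OF that] that by (intro left_conf_quotient_tendsto) (auto simp: u_def)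
  have right: "(right_conf_quotient \<alpha> b g t \<longlongrightarrow> - \<phi> t) (at 0)" if "t \<in> {a<..<b}" for t
    using G(2)[OF that] that by (intro right_conf_quotient_tendsto) (auto simp: v_def)
  let ?L = "\<lambda>t. left_conf_deriv \<alpha> a f t * g t * (t - a) powr (\<alpha> - 1)"
    and ?R = "\<lambda>t. f t * right_conf_deriv \<alpha> b g t * (b - t) powr (\<alpha> - 1)"
  \<comment> \<open>The minus sign in \<open>right_conf_deriv\<close> cancels the one in the limit
    \<open>- \<phi> t\<close>, so \<open>?R t\<close> is \<open>v t * f t\<close>. It is written
    with a double negation to match integration by parts, where the derivative of g is
    \<open>- v t\<close>.\<close>
  have uG: "?L t = u t * g t"
    and vF: "?R t = - (- v t * f t)"
    if "t \<in> {a<..<b}" for t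
    using tendsto_Lim[OF _ left[OF that]] tendsto_Lim[OF _ right[OF that]]
    by (simp_all add: left_conf_deriv_def right_conf_deriv_def u_def v_def)
  have v': "(\<lambda>t. - v t) absolutely_integrable_on {a..b}" "continuous_on {a<..<b} (\<lambda>t. - v t)"
    using v by (auto intro: continuous_intros simp: set_integrable_def)
  have parts: "interval_lebesgue_integrable lborel (ereal a) (ereal b) (\<lambda>t. u t * g t)"
    "interval_lebesgue_integrable lborel (ereal a) (ereal b) (\<lambda>t. - v t * f t)"
    "(LBINT t=ereal a..ereal b. u t * g t) + (LBINT t=ereal a..ereal b. - v t * f t) =
      f b * g b - f a * g a"
    by (rule interval_integral_by_parts[OF assms(3) F G u v']; assumption)+
  have "left_conf_differentiable \<alpha> a f t \<and> right_conf_differentiable \<alpha> b g t"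
    if "t \<in> {a<..<b}" for t
    using left[OF that] right[OF that]
    by (auto simp: left_conf_differentiable_def right_conf_differentiable_def)
  moreover have "interval_lebesgue_integrable lborel (ereal a) (ereal b) ?L"
    using interval_lebesgue_cong_Ioo(1)[OF assms(3), of ?L "\<lambda>t. u t * g t"] uG parts(1) by blast
  moreover have "interval_lebesgue_integrable lborel (ereal a) (ereal b) (\<lambda>t. - (- v t * f t))"
    using parts(2) assms(3) by (simp add: interval_lebesgue_integrable_def set_integrable_def)
  then have "interval_lebesgue_integrable lborel (ereal a) (ereal b) ?R"
    using interval_lebesgue_cong_Ioo(1)[OF assms(3), of ?R "\<lambda>t. - (- v t * f t)"] vF by blast
  moreover have "(LBINT t=ereal a..ereal b. ?L t) = (LBINT t=ereal a..ereal b. u t * g t)"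
    by (rule interval_lebesgue_cong_Ioo(2)[OF assms(3)]) (rule uG)
  moreover have "(LBINT t=ereal a..ereal b. ?R t) = (LBINT t=ereal a..ereal b. - (- v t * f t))"
    by (rule interval_lebesgue_cong_Ioo(2)[OF assms(3)]) (rule vF)
  then have "(LBINT t=ereal a..ereal b. ?R t) = - (LBINT t=ereal a..ereal b. - v t * f t)"
    by (simp only: interval_lebesgue_integral_uminus)
  \<comment> \<open>The second integral in \<open>parts(3)\<close> is minus the integral of
    \<open>?R\<close>; moving it across gives the claim.\<close>
  ultimately show ?thesis
    using parts(3) by (intro conjI ballI) auto
qed

end
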